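(* Let $\mathcal{I} = (\mathcal{F}_i)_{i=1}^n$ be an instance of the hiring problem. There exists a TIF family of stopping rules $\{\mathrm{OnTIF}^\pi\}_{\pi\in S_n}$ for $\mathcal{I}$ such that \[ \mathbb{E}[\mathrm{OnTIF}^\pi] \ge \tfrac12\,\mathbb{E}[\max_i X_i]\quad\text{for all }\pi\in S_n, \] and moreover each $\mathrm{OnTIF}^\pi$ is also IIF (as a stopping rule for ordering $\pi$). Finally, the inequality is tight: for every $c>1/2$ there is an instance and an ordering $\pi$ such that every TIF family $\{\mathrm{ALG}^\sigma\}_{\sigma\in S_n}$ satisfies $\mathbb{E}[\mathrm{ALG}^\pi] < c\,\mathbb{E}[\max_i X_i]$.
   Context: Hiring problem: $n$ candidates; candidate $i$ has a nonnegative random value $X_i\sim\mathcal{F}_i$, the $X_i$ independent, each $\mathcal{F}_i$ discrete; $f_i(x)=\Pr[X_i=x]$, $\mathcal{S}=\bigcup_i\{x:f_i(x)>0\}$. For a permutation $\pi$ of $[n]$ (arrival ordering), at step $t$ candidate $\pi(t)$ arrives, $X_{\pi(t)}$ is revealed, and the decision maker either hires $\pi(t)$ (and stops) or rejects it irrevocably. A stopping rule for ordering $\pi$ is a possibly randomized procedure knowing $n$, the $\mathcal{F}_i$, $\pi$, deciding at step $t$ using only $X_{\pi(1)},\dots,X_{\pi(t)}$ (and own randomness), hiring at most one candidate; its name also denotes the hired value ($0$ if none). A stopping rule is IIF if there is $p:\mathcal{S}\to[0,1]$ with $\Pr[\mathrm{ALG}\text{ hires } i\mid X_i=x]=p(x)$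 for all $i\in[n]$, $x\in\mathcal{S}$. A family $\{\mathrm{ALG}^\pi\}_{\pi\in S_n}$ (one stopping rule per ordering) is TIF if there is $p:[n]\times\mathcal{S}\to[0,1]$ with $\Pr[\mathrm{ALG}^\pi\text{ hires } i\mid X_i=x]=p(i,x)$ for all $i,x,\pi$. *)

theory Defs
  imports "HOL-Probability.Probability" "HOL-Combinatorics.Permutations"
begin

definition hiring_instance :: "nat \<Rightarrow> (nat \<Rightarrow> real pmf) \<Rightarrow> bool" where
  "hiring_instance n F \<longleftrightarrow> n \<ge> 1 \<and> (\<forall>i\<in>{1..n}. set_pmf (F i) \<subseteq> {0..})"

definition value_support :: "nat \<Rightarrow> (nat \<Rightarrow> real pmf) \<Rightarrow> real set" where
  "value_support n F = (\<Union>i\<in>{1..n}. {x. pmf (F i) x > 0})"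

definition values_pmf :: "nat \<Rightarrow> (nat \<Rightarrow> real pmf) \<Rightarrow> (nat \<Rightarrow> real) pmf" where
  "values_pmf n F = Pi_pmf {1..n} 0 F"

definition expected_max :: "nat \<Rightarrow> (nat \<Rightarrow> real pmf) \<Rightarrow> ennreal" where
  "expected_max n F = (\<integral>\<^sup>+ X. ennreal (MAX i\<in>{1..n}. X i) \<partial>measure_pmf (values_pmf n F))"

text \<open>
  The internal randomness of a stopping rule is a random element (seed) of an arbitrary
  probability space, drawn once, before the first arrival, and independently of the values; so the
  random choices made at different steps may be correlated. For a seed \<open>u\<close> and a list \<open>h\<close> of the
  values revealed so far (in order of arrival, the current one last), \<open>decide R u h\<close> says whether
  the current candidate is hired, provided nobody has been hired before.
\<close>

record stopping_rule =
  seed :: "real measure"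
  decide :: "real \<Rightarrow> real list \<Rightarrow> bool"

definition valid_rule :: "stopping_rule \<Rightarrow> bool" where
  "valid_rule R \<longleftrightarrow> prob_space (seed R) \<and>
     (\<lambda>(u, h). decide R u h) \<in> seed R \<Otimes>\<^sub>M count_space UNIV \<rightarrow>\<^sub>M count_space UNIV"

definition history :: "(nat \<Rightarrow> nat) \<Rightarrow> (nat \<Rightarrow> real) \<Rightarrow> nat \<Rightarrow> real list" where
  "history \<pi> X t = map (\<lambda>s. X (\<pi> s)) [1..<Suc t]"

definition hired :: "nat \<Rightarrow> (nat \<Rightarrow> nat) \<Rightarrow> stopping_rule \<Rightarrow> (nat \<Rightarrow> real) \<Rightarrow> real \<Rightarrow> nat option" where
  "hired n \<pi> R X u = map_option \<pi> (find (\<lambda>t. decide R u (history \<pi> X t)) [1..<Suc n])"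

definition hired_value :: "nat \<Rightarrow> (nat \<Rightarrow> nat) \<Rightarrow> stopping_rule \<Rightarrow> (nat \<Rightarrow> real) \<Rightarrow> real \<Rightarrow> real" where
  "hired_value n \<pi> R X u = (case hired n \<pi> R X u of None \<Rightarrow> 0 | Some i \<Rightarrow> X i)"

definition run_space ::
  "nat \<Rightarrow> (nat \<Rightarrow> real pmf) \<Rightarrow> stopping_rule \<Rightarrow> ((nat \<Rightarrow> real) \<times> real) measure" where
  "run_space n F R = measure_pmf (values_pmf n F) \<Otimes>\<^sub>M seed R"

definition expected_value ::
  "nat \<Rightarrow> (nat \<Rightarrow> real pmf) \<Rightarrow> (nat \<Rightarrow> nat) \<Rightarrow> stopping_rule \<Rightarrow> ennreal" where
  "expected_value n F \<pi> R =
     (\<integral>\<^sup>+ \<omega>. ennreal (hired_value n \<pi> R (fst \<omega>) (snd \<omega>)) \<partial>run_space n F R)"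

definition hire_prob ::
  "nat \<Rightarrow> (nat \<Rightarrow> real pmf) \<Rightarrow> (nat \<Rightarrow> nat) \<Rightarrow> stopping_rule \<Rightarrow> nat \<Rightarrow> real \<Rightarrow> real" where
  "hire_prob n F \<pi> R i x =
     \<P>(\<omega> in run_space n F R. hired n \<pi> R (fst \<omega>) (snd \<omega>) = Some i \<bar> fst \<omega> i = x)"

text \<open>
  The conditional probability given \<open>X\<^sub>i = x\<close> is defined only if that event has positive
  probability (\<^const>\<open>cond_prob\<close> returns the junk value 0 otherwise), so IIF and TIF
  constrain exactly the pairs \<open>(i, x)\<close> with \<open>f\<^sub>i(x) > 0\<close>.
\<close>

definition IIF ::
  "nat \<Rightarrow> (nat \<Rightarrow> real pmf) \<Rightarrow> (nat \<Rightarrow> nat) \<Rightarrow> stopping_rule \<Rightarrow> bool" where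
  "IIF n F \<pi> R \<longleftrightarrow>
     (\<exists>p :: real \<Rightarrow> real. (\<forall>x\<in>value_support n F. p x \<in> {0..1}) \<and>
       (\<forall>i\<in>{1..n}. \<forall>x\<in>value_support n F. pmf (F i) x > 0 \<longrightarrow> hire_prob n F \<pi> R i x = p x))"

definition stopping_rule_family :: "nat \<Rightarrow> ((nat \<Rightarrow> nat) \<Rightarrow> stopping_rule) \<Rightarrow> bool" where
  "stopping_rule_family n A \<longleftrightarrow> (\<forall>\<pi>. \<pi> permutes {1..n} \<longrightarrow> valid_rule (A \<pi>))"

definition TIF ::
  "nat \<Rightarrow> (nat \<Rightarrow> real pmf) \<Rightarrow> ((nat \<Rightarrow> nat) \<Rightarrow> stopping_rule) \<Rightarrow> bool" where
  "TIF n F A \<longleftrightarrow>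
     (\<exists>p :: nat \<Rightarrow> real \<Rightarrow> real. (\<forall>i\<in>{1..n}. \<forall>x\<in>value_support n F. p i x \<in> {0..1}) \<and>
       (\<forall>i\<in>{1..n}. \<forall>x\<in>value_support n F. \<forall>\<pi>. \<pi> permutes {1..n} \<longrightarrow>
          pmf (F i) x > 0 \<longrightarrow> hire_prob n F \<pi> (A \<pi>) i x = p i x))"

end

theory Submission
  imports Defs
begin

text \<open>
  Choose a threshold \<open>\<tau>\<close> and a tie-breaking probability at \<open>\<tau>\<close>, giving a selection probability
  \<open>\<alpha>(x)\<close>, such that \<open>\<Sum>\<^sub>i E[\<alpha>(X\<^sub>i)] = 1\<close>, and put \<open>p = \<alpha>/2\<close>. A rule hiring \<open>i\<close> given
  \<open>X\<^sub>i = x\<close> with probability exactly \<open>p(x)\<close> in any arrival order accepts \<open>x\<close> with conditional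
  probability \<open>p(x)\<close> divided by the probability that the earlier candidates were all rejected;
  this is at most 1 because \<open>p \<le> 1/2\<close> and the total hiring probability is \<open>1/2\<close>. The rule earns
  \<open>1/2 \<Sum>\<^sub>i E[X\<^sub>i \<alpha>(X\<^sub>i)] = 1/2 (\<tau> + \<Sum>\<^sub>i E[(X\<^sub>i - \<tau>)\<^sup>+])\<close>, and the bracket is at least
  \<open>E[max\<^sub>i X\<^sub>i]\<close>.

  For tightness: with \<open>X\<^sub>1 = 1\<close> followed by \<open>X\<^sub>2 = 1/\<epsilon>\<close> with probability \<open>\<epsilon>\<close>
  and 0 otherwise, no stopping rule earns more than 1, while \<open>E[max] = 2 - \<epsilon>\<close>.
\<close>

section \<open>Measurability of the hiring process\<close>

lemma measurable_find:
  assumes "\<And>t. t \<in> set ts \<Longrightarrow> Measurable.pred M (P t)"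
  shows "(\<lambda>\<omega>. find (\<lambda>t. P t \<omega>) ts) \<in> M \<rightarrow>\<^sub>M count_space UNIV"
  using assms by (induction ts) (auto intro!: measurable_If)

text \<open>Value profiles carry the discrete sigma-algebra, so an arbitrary function
  \<open>f\<close> of the profile is measurable; joint measurability in seed and history is what
  \<open>valid_rule\<close> provides.\<close>

lemma measurable_decide:
  assumes "valid_rule R"
  shows "Measurable.pred (run_space n F R) (\<lambda>\<omega>. decide R (snd \<omega>) (f (fst \<omega>)))"
proof -
  have 1: "(\<lambda>\<omega>. (snd \<omega>, f (fst \<omega>))) \<in> run_space n F R \<rightarrow>\<^sub>M seed R \<Otimes>\<^sub>M count_space UNIV"
    unfolding run_space_def
    by (intro measurable_Pair measurable_snd measurable_compose[OF measurable_fst]) simp_all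
  have 2: "(\<lambda>(u, h). decide R u h) \<in> seed R \<Otimes>\<^sub>M count_space UNIV \<rightarrow>\<^sub>M count_space UNIV"
    using assms by (simp add: valid_rule_def)
  show ?thesis
    using measurable_compose[OF 1 2] by simp
qed

lemma measurable_hired:
  assumes "valid_rule R"
  shows "(\<lambda>\<omega>. hired n \<pi> R (fst \<omega>) (snd \<omega>)) \<in> run_space n F R \<rightarrow>\<^sub>M count_space UNIV"
proof -
  have "(\<lambda>\<omega>. find (\<lambda>t. decide R (snd \<omega>) (history \<pi> (fst \<omega>) t)) [1..<Suc n])
      \<in> run_space n F R \<rightarrow>\<^sub>M count_space UNIV"
    by (intro measurable_find measurable_decide assms)
  then show ?thesis
    unfolding hired_def by (rule measurable_compose) simp
qed

lemma measurable_value: "(\<lambda>\<omega>. h (fst \<omega>)) \<in> run_space n F R \<rightarrow>\<^sub>M borel"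
  unfolding run_space_def by (rule measurable_compose[OF measurable_fst]) simp

lemma measurable_hired_value:
  assumes "valid_rule R"
  shows "(\<lambda>\<omega>. hired_value n \<pi> R (fst \<omega>) (snd \<omega>)) \<in> borel_measurable (run_space n F R)"
proof -
  \<comment> \<open>The hired candidate takes countably many values, so it suffices to treat each
    fixed outcome \<open>opt\<close>.\<close>
  have "(\<lambda>\<omega>. case opt of None \<Rightarrow> 0 | Some i \<Rightarrow> fst \<omega> i) \<in> borel_measurable (run_space n F R)"
    for opt :: "nat option"
    by (cases opt) (auto intro: measurable_value[of "\<lambda>X. X i" for i])
  from measurable_compose_countable[OF this measurable_hired[OF assms]]
  show ?thesis
    unfolding hired_value_def .
qed

section \<open>Marginals of the values\<close>

lemma nn_integral_values_component:
  assumes "i \<in> {1..n}"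
  shows "(\<integral>\<^sup>+X. f (X i) \<partial>measure_pmf (values_pmf n F)) = (\<integral>\<^sup>+x. f x \<partial>measure_pmf (F i))"
proof -
  have "map_pmf (\<lambda>X. X i) (values_pmf n F) = F i"
    unfolding values_pmf_def using assms by (subst Pi_pmf_component) auto
  then show ?thesis
    by (metis nn_integral_map_pmf)
qed

text \<open>This is the denominator of the conditional probability in \<open>hire_prob\<close>; the
  seed contributes a factor 1.\<close>

lemma emeasure_run_space_value:
  assumes "valid_rule R" "i \<in> {1..n}"
  shows "emeasure (run_space n F R) {\<omega> \<in> space (run_space n F R). fst \<omega> i = x} = pmf (F i) x"
proof -
  interpret prob_space "seed R"
    using assms(1) by (simp add: valid_rule_def)
  have "{\<omega> \<in> space (run_space n F R). fst \<omega> i = x} = {X. X i = x} \<times> space (seed R)"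
    by (auto simp: run_space_def space_pair_measure)
  also have "emeasure (run_space n F R) \<dots> = emeasure (measure_pmf (values_pmf n F)) {X. X i = x}"
    unfolding run_space_def by (subst emeasure_pair_measure_Times) (auto simp: emeasure_space_1)
  also have "\<dots> = (\<integral>\<^sup>+X. indicator {X. X i = x} X \<partial>measure_pmf (values_pmf n F))"
    by simp
  also have "\<dots> = (\<integral>\<^sup>+X. indicator {x} (X i) \<partial>measure_pmf (values_pmf n F))"
    by (intro nn_integral_cong) (simp split: split_indicator)
  also have "\<dots> = pmf (F i) x"
    by (subst nn_integral_values_component[OF assms(2)]) (simp add: emeasure_pmf_single)
  finally show ?thesis .
qed

section \<open>Rules with prescribed acceptance ratios\<close>

text \<open>
  Accepting the value \<open>x\<close> at step \<open>s\<close> (counted from 0) with conditional probability \<open>r s x\<close>,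
  independently over the steps, is realised with a single uniform seed \<open>u\<close>: one stops as soon as
  \<open>u\<close> falls below the probability of having stopped given the values seen.
\<close>

definition ratio_rule :: "(nat \<Rightarrow> real \<Rightarrow> real) \<Rightarrow> stopping_rule" where
  "ratio_rule r = \<lparr>seed = uniform_measure lborel {0..<1},
     decide = (\<lambda>u h. u < 1 - (\<Prod>s<length h. 1 - r s (h ! s)))\<rparr>"

lemma valid_ratio_rule: "valid_rule (ratio_rule r)"
proof -
  have "prob_space (uniform_measure lborel {0..<1::real})"
    by (rule prob_space_uniform_measure) auto
  moreover have "(\<lambda>(u, h). u < 1 - (\<Prod>s<length h. 1 - r s (h ! s)))
      \<in> uniform_measure lborel {0..<1} \<Otimes>\<^sub>M count_space UNIV \<rightarrow>\<^sub>M count_space UNIV"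
  proof -
    let ?M = "uniform_measure lborel {0..<1::real} \<Otimes>\<^sub>M (count_space UNIV :: real list measure)"
    have [measurable]: "fst \<in> ?M \<rightarrow>\<^sub>M borel"
      using measurable_fst[of "uniform_measure lborel {0..<1::real}" "count_space UNIV :: real list measure"]
      by (simp cong: measurable_cong_sets)
    \<comment> \<open>Histories form a discrete space, so the stopping threshold is measurable
      whatever the ratios \<open>r\<close> are.\<close>
    have [measurable]: "(\<lambda>\<omega>. g (snd \<omega>)) \<in> ?M \<rightarrow>\<^sub>M borel" for g :: "real list \<Rightarrow> real"
      by (rule measurable_compose[OF measurable_snd]) simp
    show ?thesis
      unfolding case_prod_beta by measurable
  qed
  ultimately show ?thesis
    by (simp add: valid_rule_def ratio_rule_def)
qed

text \<open>Given the values, \<open>Q X k\<close> is the probability of rejecting the first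
  \<open>k\<close> arrivals. It is nonincreasing in \<open>k\<close>, so the thresholds
  \<open>1 - Q X k\<close> increase and the first one exceeding \<open>u\<close> identifies the
  stopping step. Here \<open>t\<close> counts from 0, while arrivals are numbered from 1.\<close>

lemma hired_ratio_rule_iff:
  assumes r: "\<And>s x. 0 \<le> r s x \<and> r s x \<le> 1" and \<pi>: "\<pi> permutes {1..n}" and t: "t < n" and u: "0 \<le> u"
  defines "Q \<equiv> \<lambda>X k. \<Prod>s<k. 1 - r s (X (\<pi> (Suc s)))"
  shows "hired n \<pi> (ratio_rule r) X u = Some (\<pi> (Suc t)) \<longleftrightarrow> 1 - Q X t \<le> u \<and> u < 1 - Q X (Suc t)"
proof -
  have dec: "decide (ratio_rule r) u (history \<pi> X k) \<longleftrightarrow> u < 1 - Q X k" for k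
    by (simp add: ratio_rule_def history_def Q_def del: upt_Suc)
  have mono: "Q X k' \<le> Q X k" if "k \<le> k'" for k k'
    using that
  proof (induction k' rule: dec_induct)
    case (step m)
    have "Q X (Suc m) = Q X m * (1 - r m (X (\<pi> (Suc m))))"
      by (simp add: Q_def)
    also have "\<dots> \<le> Q X m"
      using r by (intro mult_left_le) (auto simp: Q_def intro!: prod_nonneg)
    finally show ?case
      using step by simp
  qed simp
  have inj: "\<pi> a = \<pi> b \<longleftrightarrow> a = b" for a b
    using permutes_inj[OF \<pi>] by (auto dest: injD)
  have "hired n \<pi> (ratio_rule r) X u = Some (\<pi> (Suc t)) \<longleftrightarrow>
      find (\<lambda>t. u < 1 - Q X t) [1..<Suc n] = Some (Suc t)"
    unfolding hired_def dec by (simp add: inj del: upt_Suc)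
  also have "\<dots> \<longleftrightarrow> u < 1 - Q X (Suc t) \<and> (\<forall>j<t. \<not> u < 1 - Q X (Suc j))"
    using t by (auto simp: find_Some_iff simp del: upt_Suc)
  also have "\<dots> \<longleftrightarrow> 1 - Q X t \<le> u \<and> u < 1 - Q X (Suc t)"
  \<comment> \<open>For \<open>t = 0\<close> the lower bound is \<open>1 - Q X 0 = 0\<close>,
    supplied by \<open>0 \<le> u\<close>. For \<open>t = Suc m\<close> it is the failure to stop at
    \<open>j = m\<close>, which by monotonicity implies all earlier failures.\<close>
  proof (cases t)
    case 0
    then show ?thesis using u by (simp add: Q_def)
  next
    case (Suc m)
    show ?thesis
    proof safe
      fix j assume "1 - Q X t \<le> u" "j < t" "u < 1 - Q X (Suc j)"
      then show False using mono[of "Suc j" t] by simp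
    qed (use Suc in \<open>auto simp: not_less\<close>)
  qed
  finally show ?thesis .
qed

lemma emeasure_uniform_interval:
  assumes "0 \<le> a" "a \<le> b" "b \<le> (1::real)"
  shows "emeasure (uniform_measure lborel {0..<1}) {a..<b} = ennreal (b - a)"
proof -
  have "{0..<1} \<inter> {a..<b} = {a..<b}" using assms by auto
  then show ?thesis
    using assms by (subst emeasure_uniform_measure) (auto simp: divide_ennreal[of _ 1, simplified])
qed

lemma bij_betw_arrival:
  assumes "\<pi> permutes {1..n}"
  shows "bij_betw (\<lambda>s. \<pi> (Suc s)) {..<n} {1..n}"
proof -
  have "bij_betw Suc {..<n} {1..n}"
    by (rule bij_betw_byWitness[where f' = "\<lambda>s. s - 1"]) auto
  from bij_betw_trans[OF this permutes_imp_bij[OF assms]] show ?thesis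
    by (simp add: o_def)
qed

text \<open>Integrating over the seed first gives the length of the hiring interval, a product of
  functions of distinct coordinates of \<open>X\<close>; independence then factorises the
  expectation. The weight \<open>g\<close> is general so that an indicator yields hiring
  probabilities and the identity yields earnings.\<close>

lemma nn_integral_ratio_rule:
  fixes g :: "real \<Rightarrow> ennreal"
  assumes r: "\<And>s x. 0 \<le> r s x \<and> r s x \<le> 1" and \<pi>: "\<pi> permutes {1..n}" and t: "t < n"
  shows "(\<integral>\<^sup>+\<omega>. (if hired n \<pi> (ratio_rule r) (fst \<omega>) (snd \<omega>) = Some (\<pi> (Suc t))
             then g (fst \<omega> (\<pi> (Suc t))) else 0) \<partial>run_space n F (ratio_rule r)) =
         (\<integral>\<^sup>+x. g x * ennreal (r t x) \<partial>measure_pmf (F (\<pi> (Suc t)))) *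
         (\<Prod>s<t. \<integral>\<^sup>+x. ennreal (1 - r s x) \<partial>measure_pmf (F (\<pi> (Suc s))))"
proof -
  define Q where "Q = (\<lambda>X k. \<Prod>s<k. 1 - r s (X (\<pi> (Suc s))))"
  define U where "U = uniform_measure lborel {0..<1::real}"
  define i where "i = \<pi> (Suc t)"
  have seed: "seed (ratio_rule r) = U"
    by (simp add: ratio_rule_def U_def)
  interpret U: prob_space U
    using valid_ratio_rule[of r] by (simp add: valid_rule_def seed)
  have Q01: "0 \<le> Q X k" "Q X k \<le> 1" for X k
    using r by (auto simp: Q_def intro!: prod_nonneg prod_le_1)
  have Q_Suc: "Q X k - Q X (Suc k) = Q X k * r k (X (\<pi> (Suc k)))" for X k
    by (simp add: Q_def algebra_simps)
  have "(\<lambda>\<omega>. if hired n \<pi> (ratio_rule r) (fst \<omega>) (snd \<omega>) = Some i then g (fst \<omega> i) else 0)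
      \<in> borel_measurable (run_space n F (ratio_rule r))"
    using measurable_hired[OF valid_ratio_rule, of n \<pi> r F]
    by (intro measurable_If measurable_value) measurable
  then have "(\<integral>\<^sup>+\<omega>. (if hired n \<pi> (ratio_rule r) (fst \<omega>) (snd \<omega>) = Some i
        then g (fst \<omega> i) else 0) \<partial>run_space n F (ratio_rule r)) =
      (\<integral>\<^sup>+X. \<integral>\<^sup>+u. (if hired n \<pi> (ratio_rule r) X u = Some i then g (X i) else 0) \<partial>U
        \<partial>measure_pmf (values_pmf n F))"
    unfolding run_space_def seed by (subst U.nn_integral_fst[symmetric]) (simp_all cong: if_cong)
  also have "\<dots> = (\<integral>\<^sup>+X. g (X i) * ennreal (r t (X i)) * (\<Prod>s<t. ennreal (1 - r s (X (\<pi> (Suc s)))))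
        \<partial>measure_pmf (values_pmf n F))"
  proof (rule nn_integral_cong)
    fix X
    \<comment> \<open>The seed space is the whole real line with mass on [0,1) only, so
      nonnegativity of \<open>u\<close> holds almost everywhere.\<close>
    have "AE u in U. 0 \<le> u"
      unfolding U_def by (rule AE_uniform_measureI) auto
    then have "(\<integral>\<^sup>+u. (if hired n \<pi> (ratio_rule r) X u = Some i then g (X i) else 0) \<partial>U) =
        (\<integral>\<^sup>+u. g (X i) * indicator {1 - Q X t..<1 - Q X (Suc t)} u \<partial>U)"
      using hired_ratio_rule_iff[OF r \<pi> t, where X = X]
      by (intro nn_integral_cong_AE) (auto elim!: eventually_mono simp: Q_def i_def indicator_def)
    also have "\<dots> = g (X i) * emeasure U {1 - Q X t..<1 - Q X (Suc t)}"
      by (rule nn_integral_cmult_indicator) (simp add: U_def)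
    also have "emeasure U {1 - Q X t..<1 - Q X (Suc t)} = ennreal (Q X t * r t (X i))"
    proof -
      have "0 \<le> Q X t * r t (X i)"
        using Q01 r by simp
      then show ?thesis
        using Q01 Q_Suc[of X t] unfolding U_def i_def
        by (subst emeasure_uniform_interval) simp_all
    qed
    also have "\<dots> = ennreal (r t (X i)) * (\<Prod>s<t. ennreal (1 - r s (X (\<pi> (Suc s)))))"
      using r by (simp add: Q_def ennreal_mult' prod_ennreal mult.commute)
    finally show "(\<integral>\<^sup>+u. (if hired n \<pi> (ratio_rule r) X u = Some i then g (X i) else 0) \<partial>U) =
        g (X i) * ennreal (r t (X i)) * (\<Prod>s<t. ennreal (1 - r s (X (\<pi> (Suc s)))))"
      by (simp add: mult.assoc)
  qed
  also have "\<dots> = (\<integral>\<^sup>+x. g x * ennreal (r t x) \<partial>measure_pmf (F i)) *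
         (\<Prod>s<t. \<integral>\<^sup>+x. ennreal (1 - r s x) \<partial>measure_pmf (F (\<pi> (Suc s))))"
  proof -
    \<comment> \<open>\<open>step j\<close> is the arrival time of \<open>j\<close>, counted from 0.
      \<open>h\<close> assigns the factor 1 to candidates arriving after \<open>t\<close>, which
      turns the integrand into a product over all coordinates.\<close>
    define step where "step = (\<lambda>j. inv \<pi> j - 1)"
    define h where "h = (\<lambda>j x. let s = step j in
      if s = t then g x * ennreal (r t x) else if s < t then ennreal (1 - r s x) else 1)"
    have step: "step (\<pi> (Suc s)) = s" for s
      using permutes_inverses(2)[OF \<pi>] by (simp add: step_def)
    note bij = bij_betw_arrival[OF \<pi>]
    have split: "(\<Prod>j\<in>{1..n}. H j) = H i * (\<Prod>s<t. H (\<pi> (Suc s)))"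
      if "\<And>s. t < s \<Longrightarrow> s < n \<Longrightarrow> H (\<pi> (Suc s)) = 1" for H :: "nat \<Rightarrow> ennreal"
    proof -
      have "(\<Prod>j\<in>{1..n}. H j) = (\<Prod>s<n. H (\<pi> (Suc s)))"
        using prod.reindex_bij_betw[OF bij, of H] by simp
      also have "\<dots> = (\<Prod>s<Suc t. H (\<pi> (Suc s)))"
        using t that by (intro prod.mono_neutral_right) auto
      finally show ?thesis by (simp add: i_def mult.commute)
    qed
    have "(\<integral>\<^sup>+X. g (X i) * ennreal (r t (X i)) * (\<Prod>s<t. ennreal (1 - r s (X (\<pi> (Suc s)))))
        \<partial>measure_pmf (values_pmf n F)) =
      (\<integral>\<^sup>+X. (\<Prod>j\<in>{1..n}. h j (X j)) \<partial>measure_pmf (values_pmf n F))"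
      by (intro nn_integral_cong, subst split) (auto simp: h_def step i_def Let_def)
    also have "\<dots> = (\<Prod>j\<in>{1..n}. \<integral>\<^sup>+x. h j x \<partial>measure_pmf (F j))"
      unfolding values_pmf_def by (rule nn_integral_prod_Pi_pmf) simp
    also have "\<dots> = (\<integral>\<^sup>+x. g x * ennreal (r t x) \<partial>measure_pmf (F i)) *
         (\<Prod>s<t. \<integral>\<^sup>+x. ennreal (1 - r s x) \<partial>measure_pmf (F (\<pi> (Suc s))))"
      by (subst split) (auto simp: h_def step i_def Let_def)
    finally show ?thesis .
  qed
  finally show ?thesis
    unfolding i_def .
qed

text \<open>For \<open>s \<le> n\<close>, \<open>D s\<close> is the probability that the first
  \<open>s\<close> arrivals are all rejected. Accepting with ratio \<open>p x / D s\<close> cancels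
  this factor, so the order leaves no trace. By \<open>p1\<close> the ratio is at most 1, since
  \<open>D s\<close> never drops below 1 minus the total hiring probability.\<close>

lemma exists_prescribed_rule:
  fixes F :: "nat \<Rightarrow> real pmf" and p :: "real \<Rightarrow> real"
  assumes p0: "\<And>x. 0 \<le> p x" and lt1: "(\<Sum>i\<in>{1..n}. measure_pmf.expectation (F i) p) < 1"
    and p1: "\<And>x. p x \<le> 1 - (\<Sum>i\<in>{1..n}. measure_pmf.expectation (F i) p)"
    and \<pi>: "\<pi> permutes {1..n}"
  shows "\<exists>R. valid_rule R \<and> (\<forall>i\<in>{1..n}. \<forall>g :: real \<Rightarrow> ennreal.
    (\<integral>\<^sup>+\<omega>. (if hired n \<pi> R (fst \<omega>) (snd \<omega>) = Some i then g (fst \<omega> i) else 0) \<partial>run_space n F R) =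
    (\<integral>\<^sup>+x. g x * ennreal (p x) \<partial>measure_pmf (F i)))"
proof -
  define e where "e = (\<lambda>i. measure_pmf.expectation (F i) p)"
  define D where "D = (\<lambda>s. 1 - (\<Sum>k<s. e (\<pi> (Suc k))))"
  \<comment> \<open>The ratio is 0 from \<open>n\<close> on: \<open>D s\<close> is controlled only
    for \<open>s \<le> n\<close>, while the bounds on \<open>r\<close> must hold for every
    \<open>s\<close>.\<close>
  define r where "r = (\<lambda>s x. if s < n then p x / D s else 0)"
  have e0: "0 \<le> e i" for i
    unfolding e_def using p0 by simp
  note bij = bij_betw_arrival[OF \<pi>]
  have Dge: "1 - (\<Sum>i\<in>{1..n}. e i) \<le> D s" if "s \<le> n" for s
  proof -
    have "(\<Sum>k<s. e (\<pi> (Suc k))) \<le> (\<Sum>k<n. e (\<pi> (Suc k)))"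
      using that e0 by (intro sum_mono2) auto
    also have "\<dots> = (\<Sum>i\<in>{1..n}. e i)"
      using sum.reindex_bij_betw[OF bij, of e] by simp
    finally show ?thesis by (simp add: D_def)
  qed
  have Dpos: "0 < D s" and Dp: "p x \<le> D s" if "s \<le> n" for s x
    using Dge[OF that] lt1 p1[of x] unfolding e_def by linarith+
  have r01: "0 \<le> r s x \<and> r s x \<le> 1" for s x
    using Dpos[of s] Dp[of s x] p0[of x] by (auto simp: r_def)
  have int: "integrable (measure_pmf (F i)) p" for i
  proof (rule measure_pmf.integrable_const_bound[where B = 1])
    have "p x \<le> 1" for x
      using Dp[of 0 x] by (simp add: D_def)
    then show "AE x in measure_pmf (F i). norm (p x) \<le> 1"
      using p0 by simp
  qed simp
  \<comment> \<open>Survival probabilities telescope: with \<open>e\<close> the hiring probability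
    of the next arrival, \<open>D t * (1 - e / D t) = D t - e = D (Suc t)\<close>.\<close>
  have surv: "(\<Prod>s<t. \<integral>\<^sup>+x. ennreal (1 - r s x) \<partial>measure_pmf (F (\<pi> (Suc s)))) = ennreal (D t)"
    if "t \<le> n" for t
    using that
  proof (induction t)
    case 0
    then show ?case by (simp add: D_def)
  next
    case (Suc t)
    have "(\<integral>\<^sup>+x. ennreal (1 - r t x) \<partial>measure_pmf (F (\<pi> (Suc t)))) =
        ennreal (measure_pmf.expectation (F (\<pi> (Suc t))) (\<lambda>x. 1 - r t x))"
    proof (rule nn_integral_eq_integral)
      show "integrable (measure_pmf (F (\<pi> (Suc t)))) (\<lambda>x. 1 - r t x)"
        using int Suc.prems by (simp add: r_def)
    qed (simp add: r01)
    also have "measure_pmf.expectation (F (\<pi> (Suc t))) (\<lambda>x. 1 - r t x) = 1 - e (\<pi> (Suc t)) / D t"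
      using Suc.prems int by (simp add: r_def e_def)
    also have "1 - e (\<pi> (Suc t)) / D t = D (Suc t) / D t"
      using Dpos[of t] Suc.prems by (simp add: field_simps D_def)
    finally have "(\<Prod>s<Suc t. \<integral>\<^sup>+x. ennreal (1 - r s x) \<partial>measure_pmf (F (\<pi> (Suc s)))) =
        ennreal (D t) * ennreal (D (Suc t) / D t)"
      using Suc by simp
    also have "\<dots> = ennreal (D (Suc t))"
      using Dpos[of t] Suc.prems by (subst ennreal_mult'[symmetric]) auto
    finally show ?case .
  qed
  have "(\<integral>\<^sup>+\<omega>. (if hired n \<pi> (ratio_rule r) (fst \<omega>) (snd \<omega>) = Some i then g (fst \<omega> i) else 0)
      \<partial>run_space n F (ratio_rule r)) = (\<integral>\<^sup>+x. g x * ennreal (p x) \<partial>measure_pmf (F i))"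
    if i: "i \<in> {1..n}" for i g
  proof -
    obtain t where t: "t < n" "i = \<pi> (Suc t)"
      using i bij_betw_imp_surj_on[OF bij] by force
    have "(\<integral>\<^sup>+x. g x * ennreal (r t x) \<partial>measure_pmf (F i)) * ennreal (D t) =
        (\<integral>\<^sup>+x. g x * ennreal (r t x) * ennreal (D t) \<partial>measure_pmf (F i))"
      by (rule nn_integral_multc[symmetric]) simp
    also have "\<dots> = (\<integral>\<^sup>+x. g x * ennreal (p x) \<partial>measure_pmf (F i))"
      using Dpos[of t] r01 t
      by (intro nn_integral_cong) (simp add: mult.assoc r_def flip: ennreal_mult'')
    finally show ?thesis
      using nn_integral_ratio_rule[where r = r and g = g and F = F, OF r01 \<pi> t(1)] surv[of t] t by (simp cong: if_cong)
  qed
  then show ?thesis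
    using valid_ratio_rule by blast
qed

text \<open>Taking for \<open>g\<close> the indicator of \<open>x\<close> gives the joint
  probability \<open>p x * pmf (F i) x\<close> of hiring \<open>i\<close> and seeing
  \<open>x\<close>; dividing by the positive \<open>pmf (F i) x\<close> leaves
  \<open>p x\<close>.\<close>

lemma hire_prob_eqI:
  assumes R: "valid_rule R" and i: "i \<in> {1..n}" and x: "0 < pmf (F i) x" and p0: "0 \<le> p x"
    and eq: "\<And>g :: real \<Rightarrow> ennreal.
      (\<integral>\<^sup>+\<omega>. (if hired n \<pi> R (fst \<omega>) (snd \<omega>) = Some i then g (fst \<omega> i) else 0) \<partial>run_space n F R) =
      (\<integral>\<^sup>+x. g x * ennreal (p x) \<partial>measure_pmf (F i))"
  shows "hire_prob n F \<pi> R i x = p x"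
proof -
  let ?M = "run_space n F R"
  have [measurable]: "(\<lambda>\<omega>. hired n \<pi> R (fst \<omega>) (snd \<omega>)) \<in> ?M \<rightarrow>\<^sub>M count_space UNIV"
    by (rule measurable_hired[OF R])
  have [measurable]: "(\<lambda>\<omega>. fst \<omega> i) \<in> ?M \<rightarrow>\<^sub>M borel"
    by (rule measurable_value)
  let ?A = "{\<omega> \<in> space ?M. hired n \<pi> R (fst \<omega>) (snd \<omega>) = Some i \<and> fst \<omega> i = x}"
  have "emeasure ?M ?A = (\<integral>\<^sup>+\<omega>. indicator ?A \<omega> \<partial>?M)"
    by (rule nn_integral_indicator[symmetric]) measurable
  also have "\<dots> = (\<integral>\<^sup>+\<omega>. (if hired n \<pi> R (fst \<omega>) (snd \<omega>) = Some i
      then indicator {x} (fst \<omega> i) else 0) \<partial>?M)"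
    by (intro nn_integral_cong) (auto split: split_indicator)
  also have "\<dots> = (\<integral>\<^sup>+y. indicator {x} y * ennreal (p y) \<partial>measure_pmf (F i))"
    by (rule eq)
  also have "\<dots> = (\<integral>\<^sup>+y. ennreal (p x) * indicator {x} y \<partial>measure_pmf (F i))"
    by (intro nn_integral_cong) (auto split: split_indicator)
  also have "\<dots> = ennreal (p x * pmf (F i) x)"
    using p0 by (subst nn_integral_cmult_indicator) (simp_all add: emeasure_pmf_single ennreal_mult')
  finally have "measure ?M ?A = p x * pmf (F i) x"
    using p0 by (simp add: measure_def)
  moreover have "measure ?M {\<omega> \<in> space ?M. fst \<omega> i = x} = pmf (F i) x"
    using emeasure_run_space_value[OF R i, of F x] by (simp add: measure_def)
  ultimately show ?thesis
    using x by (simp add: hire_prob_def cond_prob_def)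
qed

text \<open>At most one summand is nonzero in each run. Since \<open>\<pi>\<close> is arbitrary
  here, the hired index may lie outside \<open>{1..n}\<close>, whence an inequality.\<close>

lemma sum_hired_le_expected_value:
  assumes R: "valid_rule R"
  shows "(\<Sum>i\<in>{1..n}. \<integral>\<^sup>+\<omega>. (if hired n \<pi> R (fst \<omega>) (snd \<omega>) = Some i then ennreal (fst \<omega> i) else 0)
      \<partial>run_space n F R) \<le> expected_value n F \<pi> R"
proof -
  have [measurable]: "(\<lambda>\<omega>. if hired n \<pi> R (fst \<omega>) (snd \<omega>) = Some i then ennreal (fst \<omega> i) else 0)
      \<in> borel_measurable (run_space n F R)" for i
    using measurable_hired[OF R, of n \<pi> F]
    by (intro measurable_If measurable_value) measurable
  show ?thesis
    unfolding expected_value_def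
  proof (subst nn_integral_sum[symmetric], measurable, rule nn_integral_mono)
    fix \<omega>
    show "(\<Sum>i\<in>{1..n}. if hired n \<pi> R (fst \<omega>) (snd \<omega>) = Some i then ennreal (fst \<omega> i) else 0)
        \<le> ennreal (hired_value n \<pi> R (fst \<omega>) (snd \<omega>))"
    proof (cases "hired n \<pi> R (fst \<omega>) (snd \<omega>)")
      case (Some j)
      then have "(\<Sum>i\<in>{1..n}. if hired n \<pi> R (fst \<omega>) (snd \<omega>) = Some i then ennreal (fst \<omega> i) else 0) =
          (\<Sum>i\<in>{1..n}. if j = i then ennreal (fst \<omega> i) else 0)"
        by simp
      also have "\<dots> \<le> ennreal (fst \<omega> j)"
        by (subst sum.delta') auto
      finally show ?thesis
        using Some by (simp add: hired_value_def)
    qed simp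
  qed
qed

section \<open>The threshold\<close>

text \<open>\<open>\<tau>\<close> is the \<open>1 - q\<close> quantile. Right continuity of the
  distribution function bounds the mass above \<open>\<tau>\<close> by \<open>q\<close>, and its
  left limit bounds the mass below by \<open>1 - q\<close>; a fraction \<open>\<theta>\<close> of
  the atom at \<open>\<tau>\<close> makes up the difference.\<close>

lemma randomized_quantile:
  fixes M :: "real pmf"
  assumes nonneg: "set_pmf M \<subseteq> {0..}" and q: "0 < q" "q \<le> 1"
  shows "\<exists>\<tau> \<theta>. 0 \<le> \<tau> \<and> 0 \<le> \<theta> \<and> \<theta> \<le> 1 \<and> measure_pmf.prob M {\<tau><..} + \<theta> * pmf M \<tau> = q"
proof -
  \<comment> \<open>\<open>B\<close> is the law of \<open>M\<close> on the Borel sets, where limits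
    and continuity of \<open>cdf\<close> apply.\<close>
  define B where "B = distr (measure_pmf M) borel (\<lambda>x. x)"
  interpret B: real_distribution B
    unfolding B_def real_distribution_def real_distribution_axioms_def
    by (auto intro: measure_pmf.prob_space_distr)
  have B: "measure B A = measure_pmf.prob M A" if "A \<in> sets borel" for A
    using that unfolding B_def by (subst measure_distr) auto
  \<comment> \<open>Restricting to \<open>0 \<le> t\<close> keeps the infimum finite and nonnegative
    even for \<open>q = 1\<close>, when every real satisfies the second condition.\<close>
  define T where "T = {t. 0 \<le> t \<and> 1 - q \<le> cdf B t}"
  define \<tau> where "\<tau> = Inf T"
  have "eventually (\<lambda>t. 1 - q < cdf B t) at_top"
    using B.cdf_lim_at_top_prob q by (auto intro: order_tendstoD(1))
  then obtain t0 where t0: "\<And>t. t0 \<le> t \<Longrightarrow> 1 - q < cdf B t"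
    by (auto simp: eventually_at_top_linorder)
  have T: "T \<noteq> {}" "bdd_below T"
    using t0[of "max t0 0"] by (auto simp: T_def intro!: exI[of _ "max t0 0"] bdd_belowI[of _ 0])
  have \<tau>0: "0 \<le> \<tau>"
    unfolding \<tau>_def using T(1) by (intro cInf_greatest) (auto simp: T_def)
  have "1 - q \<le> cdf B \<tau>"
  proof (rule tendsto_lowerbound)
    show "(cdf B \<longlongrightarrow> cdf B \<tau>) (at_right \<tau>)"
      using B.cdf_is_right_cont by (simp add: continuous_within)
    have "1 - q \<le> cdf B t" if t: "\<tau> < t" for t
    proof -
      obtain s where "s \<in> T" "s < t"
        using t cInf_less_iff[OF T, of t] unfolding \<tau>_def by auto
      then show ?thesis
        using B.cdf_nondecreasing[of s t] by (simp add: T_def)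
    qed
    then show "\<forall>\<^sub>F t in at_right \<tau>. 1 - q \<le> cdf B t"
      by (auto simp: eventually_at_filter)
  qed simp
  moreover have "measure_pmf.prob M {..\<tau>} + measure_pmf.prob M {\<tau><..} = 1"
  proof -
    have "{..\<tau>} \<union> {\<tau><..} = UNIV" "{..\<tau>} \<inter> {\<tau><..} = {}" by auto
    then show ?thesis
      using measure_pmf.finite_measure_Union[of "{..\<tau>}" M "{\<tau><..}"] by auto
  qed
  ultimately have upper: "measure_pmf.prob M {\<tau><..} \<le> q"
    by (simp add: cdf_def B)
  have below: "measure_pmf.prob M {..<\<tau>} \<le> 1 - q"
  \<comment> \<open>At 0 the infimum says nothing about negative arguments, so nonnegativity of the
    values is used instead; for positive \<open>\<tau>\<close>, points just below it are outside
    \<open>T\<close>.\<close>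
  proof (cases "\<tau> = 0")
    case True
    have "measure_pmf.prob M {..<0} = 0"
      using nonneg by (subst measure_pmf_zero_iff) auto
    then show ?thesis using True q by simp
  next
    case False
    have "measure B {..<\<tau>} \<le> 1 - q"
    proof (rule tendsto_upperbound[OF B.cdf_at_left])
      have "cdf B t \<le> 1 - q" if "0 < t" "t < \<tau>" for t
        using that T cInf_lower[of t T] unfolding \<tau>_def by (force simp: T_def)
      then show "\<forall>\<^sub>F t in at_left \<tau>. cdf B t \<le> 1 - q"
        using False \<tau>0 by (auto simp: eventually_at_left[of 0 \<tau>] intro!: exI[of _ 0])
    qed simp
    then show ?thesis by (simp add: B)
  qed
  have "measure_pmf.prob M {..<\<tau>} + pmf M \<tau> + measure_pmf.prob M {\<tau><..} = 1"
  proof -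
    have "{..<\<tau>} \<union> {\<tau>} = {..\<tau>}" by auto
    then have "measure_pmf.prob M {..\<tau>} = measure_pmf.prob M {..<\<tau>} + pmf M \<tau>"
      using measure_pmf.finite_measure_Union[of "{..<\<tau>}" M "{\<tau>}"] by (simp add: pmf.rep_eq)
    then show ?thesis
      using \<open>measure_pmf.prob M {..\<tau>} + measure_pmf.prob M {\<tau><..} = 1\<close> by simp
  qed
  then have lower: "q \<le> measure_pmf.prob M {\<tau><..} + pmf M \<tau>"
    using below by linarith
  \<comment> \<open>Division by zero gives \<open>\<theta> = 0\<close> if \<open>\<tau>\<close> has
    no atom; then \<open>lower\<close> and \<open>upper\<close> already force the mass above
    \<open>\<tau>\<close> to equal \<open>q\<close>.\<close>
  define \<theta> where "\<theta> = (q - measure_pmf.prob M {\<tau><..}) / pmf M \<tau>"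
  show ?thesis
  proof (rule exI[of _ \<tau>], rule exI[of _ \<theta>], intro conjI)
    show "\<theta> \<le> 1"
      using lower pmf_nonneg[of M \<tau>] by (auto simp: \<theta>_def divide_le_eq_1 not_less)
    show "measure_pmf.prob M {\<tau><..} + \<theta> * pmf M \<tau> = q"
      using lower upper by (cases "pmf M \<tau> = 0") (auto simp: \<theta>_def)
  qed (use \<tau>0 upper in \<open>auto simp: \<theta>_def\<close>)
qed

lemma exists_threshold:
  assumes "hiring_instance n F"
  shows "\<exists>\<alpha> \<tau>. (\<forall>x. 0 \<le> \<alpha> x \<and> \<alpha> x \<le> 1) \<and> 0 \<le> \<tau> \<and> (\<forall>x. \<tau> * \<alpha> x + max 0 (x - \<tau>) = x * \<alpha> x) \<and>
    (\<Sum>i\<in>{1..n}. measure_pmf.expectation (F i) \<alpha>) = 1"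
proof -
  have n: "1 \<le> n" and supp: "\<And>i. i \<in> {1..n} \<Longrightarrow> set_pmf (F i) \<subseteq> {0..}"
    using assms by (auto simp: hiring_instance_def)
  \<comment> \<open>\<open>M\<close> is the value of a uniformly chosen candidate. Selecting from it
    with probability \<open>1 / n\<close> means that the individual selection probabilities average
    \<open>1 / n\<close>, hence sum to 1.\<close>
  define M where "M = pmf_of_set {1..n} \<bind> F"
  have "set_pmf M \<subseteq> {0..}"
    using n supp by (force simp: M_def)
  then obtain \<tau> \<theta> where \<tau>: "0 \<le> \<tau>" "0 \<le> \<theta>" "\<theta> \<le> 1"
      "measure_pmf.prob M {\<tau><..} + \<theta> * pmf M \<tau> = 1 / real n"
    using randomized_quantile[of M "1 / real n"] n by auto
  define \<alpha> where "\<alpha> x = (if \<tau> < x then 1 else if x = \<tau> then \<theta> else 0)" for x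
  have \<alpha>: "\<alpha> = (\<lambda>x. indicator {\<tau><..} x + \<theta> * indicator {\<tau>} x)"
    by (auto simp: \<alpha>_def indicator_def)
  have E: "measure_pmf.expectation N \<alpha> = measure_pmf.prob N {\<tau><..} + \<theta> * pmf N \<tau>" for N
    unfolding \<alpha> by (subst Bochner_Integration.integral_add)
      (auto simp: pmf.rep_eq intro!: measure_pmf.integrable_const_bound[where B = 1])
  have \<alpha>01: "0 \<le> \<alpha> x" "\<alpha> x \<le> 1" for x
    using \<tau> by (auto simp: \<alpha>_def)
  have int: "integrable (measure_pmf N) \<alpha>" for N
    using \<alpha>01 by (intro measure_pmf.integrable_const_bound[where B = 1]) auto
  then have nn: "(\<integral>\<^sup>+x. ennreal (\<alpha> x) \<partial>measure_pmf N) = ennreal (measure_pmf.expectation N \<alpha>)" for N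
    using \<alpha>01 by (intro nn_integral_eq_integral) auto
  have "ennreal (1 / real n) = (\<integral>\<^sup>+x. ennreal (\<alpha> x) \<partial>measure_pmf M)"
    using \<tau>(4) E nn by simp
  also have "\<dots> = (\<integral>\<^sup>+i. ennreal (measure_pmf.expectation (F i) \<alpha>) \<partial>measure_pmf (pmf_of_set {1..n}))"
    by (simp only: M_def nn_integral_bind_pmf flip: nn)
  also have "\<dots> = ennreal ((\<Sum>i\<in>{1..n}. measure_pmf.expectation (F i) \<alpha>) / real n)"
    using n \<alpha>01
    by (subst nn_integral_eq_integral) (auto simp: integral_pmf_of_set intro!: integrable_measure_pmf_finite)
  finally have "1 / real n = (\<Sum>i\<in>{1..n}. measure_pmf.expectation (F i) \<alpha>) / real n"
    using \<alpha>01 by (subst (asm) ennreal_inj) (auto intro!: divide_nonneg_nonneg sum_nonneg)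
  then have "(\<Sum>i\<in>{1..n}. measure_pmf.expectation (F i) \<alpha>) = 1"
    using n by simp
  then show ?thesis
    using \<tau>(1-3) by (intro exI[of _ \<alpha>] exI[of _ \<tau>]) (auto simp: \<alpha>_def)
qed

text \<open>Pointwise, the maximum is at most \<open>\<tau>\<close> plus the sum of all excesses
  over \<open>\<tau>\<close>. As the selection probabilities sum to 1, \<open>\<tau>\<close> can be
  distributed over the candidates, and \<open>eq\<close> recombines the two parts under each
  \<open>F i\<close>.\<close>

lemma expected_max_le:
  assumes n: "1 \<le> n" and \<alpha>: "\<And>x. 0 \<le> \<alpha> x \<and> \<alpha> x \<le> 1" and \<tau>: "0 \<le> \<tau>"
    and eq: "\<And>x. \<tau> * \<alpha> x + max 0 (x - \<tau>) = x * \<alpha> x"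
    and sum1: "(\<Sum>i\<in>{1..n}. measure_pmf.expectation (F i) \<alpha>) = 1"
  shows "expected_max n F \<le> (\<Sum>i\<in>{1..n}. \<integral>\<^sup>+x. ennreal (x * \<alpha> x) \<partial>measure_pmf (F i))"
proof -
  have "expected_max n F \<le> (\<integral>\<^sup>+X. ennreal \<tau> + (\<Sum>i\<in>{1..n}. ennreal (max 0 (X i - \<tau>)))
      \<partial>measure_pmf (values_pmf n F))"
    unfolding expected_max_def
  proof (rule nn_integral_mono)
    fix X :: "nat \<Rightarrow> real"
    have "(MAX i\<in>{1..n}. X i) \<in> X ` {1..n}"
      using n by (intro Max_in) auto
    then obtain j where j: "j \<in> {1..n}" "(MAX i\<in>{1..n}. X i) = X j"
      by auto
    have "ennreal (X j) \<le> ennreal (\<tau> + max 0 (X j - \<tau>))"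
      by (rule ennreal_leI) simp
    also have "\<dots> = ennreal \<tau> + ennreal (max 0 (X j - \<tau>))"
      using \<tau> by simp
    also have "\<dots> \<le> ennreal \<tau> + (\<Sum>i\<in>{1..n}. ennreal (max 0 (X i - \<tau>)))"
      using j(1) by (intro add_left_mono member_le_sum) auto
    finally show "ennreal (MAX i\<in>{1..n}. X i) \<le> ennreal \<tau> + (\<Sum>i\<in>{1..n}. ennreal (max 0 (X i - \<tau>)))"
      using j(2) by simp
  qed
  also have "\<dots> = ennreal \<tau> + (\<Sum>i\<in>{1..n}. \<integral>\<^sup>+X. ennreal (max 0 (X i - \<tau>)) \<partial>measure_pmf (values_pmf n F))"
    by (subst nn_integral_add) (simp_all add: nn_integral_sum del: ennreal_max_0 sum_ennreal)
  also have "\<dots> = ennreal \<tau> + (\<Sum>i\<in>{1..n}. \<integral>\<^sup>+x. ennreal (max 0 (x - \<tau>)) \<partial>measure_pmf (F i))"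
    by (intro arg_cong2[of _ _ _ _ "(+)"] refl sum.cong nn_integral_values_component)
  also have "ennreal \<tau> = (\<Sum>i\<in>{1..n}. \<integral>\<^sup>+x. ennreal (\<tau> * \<alpha> x) \<partial>measure_pmf (F i))"
  proof -
    have int: "integrable (measure_pmf (F i)) \<alpha>" for i
      using \<alpha> by (intro measure_pmf.integrable_const_bound[where B = 1]) auto
    have "(\<Sum>i\<in>{1..n}. \<integral>\<^sup>+x. ennreal (\<tau> * \<alpha> x) \<partial>measure_pmf (F i)) =
        (\<Sum>i\<in>{1..n}. ennreal (\<tau> * measure_pmf.expectation (F i) \<alpha>))"
      using int \<alpha> \<tau> by (intro sum.cong refl, subst nn_integral_eq_integral) auto
    also have "\<dots> = ennreal (\<Sum>i\<in>{1..n}. \<tau> * measure_pmf.expectation (F i) \<alpha>)"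
      using \<alpha> \<tau> by (intro sum_ennreal) (auto intro!: mult_nonneg_nonneg integral_nonneg)
    also have "\<dots> = ennreal \<tau>"
      using sum1 by (simp flip: sum_distrib_left)
    finally show ?thesis by simp
  qed
  also have "(\<Sum>i\<in>{1..n}. \<integral>\<^sup>+x. ennreal (\<tau> * \<alpha> x) \<partial>measure_pmf (F i)) +
      (\<Sum>i\<in>{1..n}. \<integral>\<^sup>+x. ennreal (max 0 (x - \<tau>)) \<partial>measure_pmf (F i)) =
      (\<Sum>i\<in>{1..n}. \<integral>\<^sup>+x. ennreal (\<tau> * \<alpha> x) + ennreal (max 0 (x - \<tau>)) \<partial>measure_pmf (F i))"
    by (simp add: nn_integral_add sum.distrib del: ennreal_max_0)
  also have "\<dots> = (\<Sum>i\<in>{1..n}. \<integral>\<^sup>+x. ennreal (x * \<alpha> x) \<partial>measure_pmf (F i))"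
    using \<alpha> \<tau> by (simp add: eq[symmetric] ennreal_plus[symmetric] del: ennreal_plus ennreal_max_0)
  finally show ?thesis .
qed

section \<open>The fair family and its guarantee\<close>

lemma exists_fair_family:
  assumes inst: "hiring_instance n F"
  shows "\<exists>A. stopping_rule_family n A \<and> TIF n F A \<and>
    (\<forall>\<pi>. \<pi> permutes {1..n} \<longrightarrow>
       ennreal (1/2) * expected_max n F \<le> expected_value n F \<pi> (A \<pi>) \<and> IIF n F \<pi> (A \<pi>))"
proof -
  obtain \<alpha> \<tau> where \<alpha>: "\<And>x. 0 \<le> \<alpha> x \<and> \<alpha> x \<le> 1" and \<tau>: "0 \<le> \<tau>"
    and eq: "\<And>x. \<tau> * \<alpha> x + max 0 (x - \<tau>) = x * \<alpha> x"
    and sum1: "(\<Sum>i\<in>{1..n}. measure_pmf.expectation (F i) \<alpha>) = 1"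
    using exists_threshold[OF inst] by blast
  define p where "p x = \<alpha> x / 2" for x
  have sum_p: "(\<Sum>i\<in>{1..n}. measure_pmf.expectation (F i) p) = 1 / 2"
    using sum1 by (simp add: p_def[abs_def] flip: sum_divide_distrib)
  have p: "0 \<le> p x" "p x \<le> 1 / 2" for x
    using \<alpha>[of x] by (auto simp: p_def)
  define fair where "fair \<pi> R \<longleftrightarrow> valid_rule R \<and> (\<forall>i\<in>{1..n}. \<forall>g :: real \<Rightarrow> ennreal.
      (\<integral>\<^sup>+\<omega>. (if hired n \<pi> R (fst \<omega>) (snd \<omega>) = Some i then g (fst \<omega> i) else 0) \<partial>run_space n F R) =
      (\<integral>\<^sup>+x. g x * ennreal (p x) \<partial>measure_pmf (F i)))" for \<pi> R
  \<comment> \<open>A separate rule is chosen for each ordering; all of them share the same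
    \<open>p\<close>.\<close>
  define A where "A \<pi> = (SOME R. fair \<pi> R)" for \<pi>
  have fair: "fair \<pi> (A \<pi>)" if "\<pi> permutes {1..n}" for \<pi>
    unfolding A_def
  proof (rule someI_ex)
    \<comment> \<open>With total hiring probability 1/2, the requirements become
      \<open>1 / 2 < 1\<close> and \<open>p x \<le> 1 / 2\<close>.\<close>
    show "\<exists>R. fair \<pi> R"
      unfolding fair_def using p that by (intro exists_prescribed_rule) (simp_all only: sum_p, simp_all)
  qed
  have A: "valid_rule (A \<pi>)" if "\<pi> permutes {1..n}" for \<pi>
    using fair[OF that] by (simp add: fair_def)
  have hire: "(\<integral>\<^sup>+\<omega>. (if hired n \<pi> (A \<pi>) (fst \<omega>) (snd \<omega>) = Some i then g (fst \<omega> i) else 0)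
      \<partial>run_space n F (A \<pi>)) = (\<integral>\<^sup>+x. g x * ennreal (p x) \<partial>measure_pmf (F i))"
    if "\<pi> permutes {1..n}" "i \<in> {1..n}" for \<pi> i and g :: "real \<Rightarrow> ennreal"
    using fair[OF that(1)] that(2) unfolding fair_def by blast
  have prob: "hire_prob n F \<pi> (A \<pi>) i x = p x"
    if "\<pi> permutes {1..n}" "i \<in> {1..n}" "0 < pmf (F i) x" for \<pi> i x
    using that by (intro hire_prob_eqI[where F = F and i = i and p = p] A p(1) hire)
  have p01: "p x \<in> {0..1}" for x
    using p(1)[of x] p(2)[of x] by auto
  have half: "ennreal (1/2) * expected_max n F \<le> expected_value n F \<pi> (A \<pi>)"
    if \<pi>: "\<pi> permutes {1..n}" for \<pi>
  proof -
    have "ennreal (1/2) * expected_max n F \<le>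
        ennreal (1/2) * (\<Sum>i\<in>{1..n}. \<integral>\<^sup>+x. ennreal (x * \<alpha> x) \<partial>measure_pmf (F i))"
      using inst by (intro mult_left_mono expected_max_le[OF _ \<alpha> \<tau> eq sum1])
        (auto simp: hiring_instance_def)
    also have "\<dots> = (\<Sum>i\<in>{1..n}. \<integral>\<^sup>+x. ennreal (1/2) * ennreal (x * \<alpha> x) \<partial>measure_pmf (F i))"
      by (subst nn_integral_cmult) (simp_all add: sum_distrib_left)
    also have "\<dots> = (\<Sum>i\<in>{1..n}. \<integral>\<^sup>+x. ennreal x * ennreal (p x) \<partial>measure_pmf (F i))"
    proof (intro sum.cong nn_integral_cong refl)
      fix x :: real
      have "ennreal (1/2) * ennreal (x * \<alpha> x) = ennreal (1/2 * (x * \<alpha> x))"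
        by (rule ennreal_mult'[symmetric]) simp
      also have "\<dots> = ennreal (x * p x)"
        by (simp add: p_def)
      also have "\<dots> = ennreal x * ennreal (p x)"
        by (rule ennreal_mult''[OF p(1)])
      finally show "ennreal (1/2) * ennreal (x * \<alpha> x) = ennreal x * ennreal (p x)" .
    qed
    also have "\<dots> = (\<Sum>i\<in>{1..n}. \<integral>\<^sup>+\<omega>. (if hired n \<pi> (A \<pi>) (fst \<omega>) (snd \<omega>) = Some i
        then ennreal (fst \<omega> i) else 0) \<partial>run_space n F (A \<pi>))"
      by (intro sum.cong refl hire[OF \<pi>, symmetric])
    also have "\<dots> \<le> expected_value n F \<pi> (A \<pi>)"
      by (rule sum_hired_le_expected_value[OF A[OF \<pi>]])
    finally show ?thesis .
  qed
  show ?thesis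
  proof (intro exI[of _ A] conjI allI impI)
    show "stopping_rule_family n A"
      using A by (simp add: stopping_rule_family_def)
    show "TIF n F A"
      \<comment> \<open>\<open>p\<close> depends on neither the ordering nor the candidate: the
        former gives TIF, the latter IIF.\<close>
      unfolding TIF_def using prob p01 by (intro exI[of _ "\<lambda>i x. p x"]) auto
    show "IIF n F \<pi> (A \<pi>)" if "\<pi> permutes {1..n}" for \<pi>
      unfolding IIF_def using prob[OF that] p01 by (intro exI[of _ p]) auto
  qed (rule half)
qed

section \<open>Tightness\<close>

definition long_shot :: "real \<Rightarrow> nat \<Rightarrow> real pmf" where
  "long_shot \<epsilon> i = (if i = 1 then return_pmf 1
     else map_pmf (\<lambda>b. if b then 1 / \<epsilon> else 0) (bernoulli_pmf \<epsilon>))"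

lemma AE_long_shot:
  assumes "0 < \<epsilon>"
  shows "AE X in measure_pmf (values_pmf 2 (long_shot \<epsilon>)). X 1 = 1 \<and> 0 \<le> X 2"
  unfolding AE_measure_pmf_iff
proof
  fix X assume "X \<in> set_pmf (values_pmf 2 (long_shot \<epsilon>))"
  then have "X i \<in> set_pmf (long_shot \<epsilon> i)" if "i \<in> {1..2}" for i
    using that by (auto simp: values_pmf_def set_Pi_pmf PiE_dflt_def)
  from this[of 1] this[of 2] show "X 1 = 1 \<and> 0 \<le> X 2"
    using assms by (auto simp: long_shot_def)
qed

lemma nn_integral_long_shot:
  assumes "0 < \<epsilon>" "\<epsilon> < 1"
  shows "(\<integral>\<^sup>+X. f (X 2) \<partial>measure_pmf (values_pmf 2 (long_shot \<epsilon>))) =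
    f (1 / \<epsilon>) * ennreal \<epsilon> + f 0 * ennreal (1 - \<epsilon>)"
  using assms by (subst nn_integral_values_component) (simp_all add: long_shot_def)

lemma expected_max_long_shot:
  assumes \<epsilon>: "0 < \<epsilon>" "\<epsilon> < 1"
  shows "expected_max 2 (long_shot \<epsilon>) = ennreal (2 - \<epsilon>)"
proof -
  have "{1..2::nat} = {1, 2}" by auto
  then have "expected_max 2 (long_shot \<epsilon>) =
      (\<integral>\<^sup>+X. ennreal (max 1 (X 2)) \<partial>measure_pmf (values_pmf 2 (long_shot \<epsilon>)))"
    unfolding expected_max_def using AE_long_shot[OF \<epsilon>(1)]
    by (intro nn_integral_cong_AE) (auto elim!: eventually_mono)
  also have "\<dots> = ennreal (1 / \<epsilon>) * ennreal \<epsilon> + ennreal (1 - \<epsilon>)"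
    using \<epsilon> by (subst nn_integral_long_shot[where f = "\<lambda>x. ennreal (max 1 x)"]) (auto simp: max_def)
  also have "\<dots> = ennreal (2 - \<epsilon>)"
    using \<epsilon> ennreal_plus[of 1 "1 - \<epsilon>"] by (simp add: ennreal_mult'[symmetric] del: ennreal_plus)
  finally show ?thesis .
qed

text \<open>Once the seed is fixed, the first decision is deterministic, because the first value is
  almost surely 1. Stopping earns 1; continuing earns at most \<open>X 2\<close>, whose mean is
  1.\<close>

lemma expected_value_long_shot_le:
  assumes \<epsilon>: "0 < \<epsilon>" "\<epsilon> < 1" and R: "valid_rule R"
  shows "expected_value 2 (long_shot \<epsilon>) id R \<le> 1"
proof -
  let ?V = "measure_pmf (values_pmf 2 (long_shot \<epsilon>))"
  interpret U: prob_space "seed R"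
    using R by (simp add: valid_rule_def)
  interpret P: pair_sigma_finite ?V "seed R" ..
  have "(\<lambda>\<omega>. ennreal (hired_value 2 id R (fst \<omega>) (snd \<omega>))) \<in> borel_measurable (?V \<Otimes>\<^sub>M seed R)"
    using measurable_hired_value[OF R, of 2 id "long_shot \<epsilon>"] unfolding run_space_def by measurable
  then have "expected_value 2 (long_shot \<epsilon>) id R =
      (\<integral>\<^sup>+u. \<integral>\<^sup>+X. ennreal (hired_value 2 id R X u) \<partial>?V \<partial>seed R)"
    unfolding expected_value_def run_space_def by (subst P.nn_integral_snd[symmetric]) simp_all
  also have "\<dots> \<le> (\<integral>\<^sup>+u. 1 \<partial>seed R)"
  proof (rule nn_integral_mono)
    fix u
    have *: "hired_value 2 id R X u \<le> (if decide R u [1] then 1 else X 2)"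
      if "X 1 = 1 \<and> 0 \<le> X 2" for X
      using that by (auto simp: hired_value_def hired_def history_def upt_rec numeral_2_eq_2)
    have "(\<integral>\<^sup>+X. ennreal (hired_value 2 id R X u) \<partial>?V) \<le>
        (\<integral>\<^sup>+X. ennreal (if decide R u [1] then 1 else X 2) \<partial>?V)"
      using AE_long_shot[OF \<epsilon>(1)]
      by (intro nn_integral_mono_AE, elim eventually_mono, intro ennreal_leI *)
    also have "\<dots> = 1"
      using \<epsilon> nn_integral_long_shot[OF \<epsilon>, of ennreal]
      by (cases "decide R u [1]") (simp_all flip: ennreal_mult')
    finally show "(\<integral>\<^sup>+X. ennreal (hired_value 2 id R X u) \<partial>?V) \<le> 1" .
  qed
  also have "\<dots> = 1"
    by (simp add: U.emeasure_space_1)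
  finally show ?thesis .
qed

lemma one_half_tight:
  fixes c :: real
  assumes c: "1/2 < c"
  shows "\<exists>n F \<pi>. hiring_instance n F \<and> \<pi> permutes {1..n} \<and>
    (\<forall>R. valid_rule R \<longrightarrow> expected_value n F \<pi> R < ennreal c * expected_max n F)"
proof -
  \<comment> \<open>This choice gives \<open>c * (2 - \<epsilon>) = c + 1/2\<close>, which exceeds
    1, and \<open>c > 1/2\<close> places \<open>\<epsilon>\<close> strictly between 0 and 1.\<close>
  define \<epsilon> where "\<epsilon> = 1 - 1 / (2 * c)"
  have \<epsilon>: "0 < \<epsilon>" "\<epsilon> < 1"
    using c by (auto simp: \<epsilon>_def)
  have gt: "1 < c * (2 - \<epsilon>)"
    using c by (simp add: \<epsilon>_def field_simps)
  have "hiring_instance 2 (long_shot \<epsilon>)"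
    using \<epsilon> by (auto simp: hiring_instance_def long_shot_def)
  moreover have "id permutes {1..2::nat}"
    by (rule permutes_id)
  moreover have "expected_value 2 (long_shot \<epsilon>) id R < ennreal c * expected_max 2 (long_shot \<epsilon>)"
    if "valid_rule R" for R
  proof -
    have "expected_value 2 (long_shot \<epsilon>) id R \<le> 1"
      by (rule expected_value_long_shot_le[OF \<epsilon> that])
    also have "(1::ennreal) < ennreal (c * (2 - \<epsilon>))"
      using gt by simp
    also have "\<dots> = ennreal c * expected_max 2 (long_shot \<epsilon>)"
      using c by (simp add: expected_max_long_shot[OF \<epsilon>] ennreal_mult')
    finally show ?thesis .
  qed
  ultimately show ?thesis by blast
qed

theorem mainTheorem13:
  shows "(\<forall>(n::nat) (F :: nat \<Rightarrow> real pmf). hiring_instance n F \<longrightarrow>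
            (\<exists>OnTIF. stopping_rule_family n OnTIF \<and> TIF n F OnTIF \<and>
               (\<forall>\<pi>. \<pi> permutes {1..n} \<longrightarrow>
                  expected_value n F \<pi> (OnTIF \<pi>) \<ge> ennreal (1/2) * expected_max n F \<and>
                  IIF n F \<pi> (OnTIF \<pi>)))) \<and>
         (\<forall>c::real. c > 1/2 \<longrightarrow>
            (\<exists>(n::nat) (F :: nat \<Rightarrow> real pmf) \<pi>. hiring_instance n F \<and> \<pi> permutes {1..n} \<and>
               (\<forall>ALG. stopping_rule_family n ALG \<and> TIF n F ALG \<longrightarrow>
                  expected_value n F \<pi> (ALG \<pi>) < ennreal c * expected_max n F)))"
proof (intro conjI allI impI)
  fix c :: real assume "1/2 < c"
  then obtain n F \<pi> where "hiring_instance n F" and \<pi>: "\<pi> permutes {1..n}"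
    and lt: "\<And>R. valid_rule R \<Longrightarrow> expected_value n F \<pi> R < ennreal c * expected_max n F"
    using one_half_tight by blast
  \<comment> \<open>The member of the family at \<open>\<pi>\<close> is a valid rule, so the bound
    for single rules applies to it.\<close>
  moreover have "expected_value n F \<pi> (A \<pi>) < ennreal c * expected_max n F"
    if "stopping_rule_family n A" for A
    using that \<pi> lt by (simp add: stopping_rule_family_def)
  ultimately show "\<exists>(n::nat) (F :: nat \<Rightarrow> real pmf) \<pi>. hiring_instance n F \<and> \<pi> permutes {1..n} \<and>
      (\<forall>ALG. stopping_rule_family n ALG \<and> TIF n F ALG \<longrightarrow>
        expected_value n F \<pi> (ALG \<pi>) < ennreal c * expected_max n F)"
    by blast
qed (rule exists_fair_family)

end
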